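(* A matroid is a gammoid if and only if it is $U_{0,0}$-constructed, i.e. it can be obtained from the empty matroid $U_{0,0}$ by a finite sequence of the operations: relabelling elements, deletion, contraction, adding coloops, and principal extensions.
   Context: Gammoids are as in Oxley's "Matroid Theory" (equivalently, contractions of transversal matroids). A principal extension of a matroid $M$ into a flat $F$ is a matroid $M'$ on $E(M)\cup\{x\}$ (with $x\notin E(M)$) such that $M'\setminus x=M$ and a subset of $E(M)$ spans $x$ in $M'$ iff it spans $F$ in $M$. *)

theory Defs
  imports Main "Graph_Theory.Vertex_Walk"
begin

section \<open>Finite matroids\<close>

record 'a pre_matroid =
  ground :: "'a set"
  indep :: "'a set set"

locale matroid =
  fixes M :: "'a pre_matroid"
  assumes finite_ground: "finite (ground M)"
    and indep_subset_ground: "I \<in> indep M \<Longrightarrow> I \<subseteq> ground M"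
    and indep_empty: "{} \<in> indep M"
    and indep_subset: "I \<in> indep M \<Longrightarrow> J \<subseteq> I \<Longrightarrow> J \<in> indep M"
    and indep_augment: "I \<in> indep M \<Longrightarrow> J \<in> indep M \<Longrightarrow> card I < card J
      \<Longrightarrow> \<exists>e \<in> J - I. insert e I \<in> indep M"

definition bases :: "'a pre_matroid \<Rightarrow> 'a set set" where
  "bases M = {B \<in> indep M. \<forall>I \<in> indep M. B \<subseteq> I \<longrightarrow> I = B}"

definition rank :: "'a pre_matroid \<Rightarrow> 'a set \<Rightarrow> nat" where
  "rank M X = Max (card ` {I \<in> indep M. I \<subseteq> X})"

definition cl :: "'a pre_matroid \<Rightarrow> 'a set \<Rightarrow> 'a set" where
  "cl M X = {e \<in> ground M. rank M (insert e X) = rank M X}"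

definition spans :: "'a pre_matroid \<Rightarrow> 'a set \<Rightarrow> 'a set \<Rightarrow> bool" where
  "spans M X Y \<longleftrightarrow> Y \<subseteq> cl M X"

definition flat :: "'a pre_matroid \<Rightarrow> 'a set \<Rightarrow> bool" where
  "flat M F \<longleftrightarrow> F \<subseteq> ground M \<and> cl M F = F"

section \<open>Operations on matroids\<close>

definition empty_matroid :: "'a pre_matroid" where
  "empty_matroid = \<lparr>ground = {}, indep = {{}}\<rparr>"

definition relabel :: "('a \<Rightarrow> 'b) \<Rightarrow> 'a pre_matroid \<Rightarrow> 'b pre_matroid" where
  "relabel f M = \<lparr>ground = f ` ground M, indep = (`) f ` indep M\<rparr>"

definition delete :: "'a pre_matroid \<Rightarrow> 'a set \<Rightarrow> 'a pre_matroid" where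
  "delete M X = \<lparr>ground = ground M - X, indep = {I \<in> indep M. I \<inter> X = {}}\<rparr>"

definition restrict :: "'a pre_matroid \<Rightarrow> 'a set \<Rightarrow> 'a pre_matroid" where
  "restrict M X = delete M (ground M - X)"

text \<open>The bases of the dual are the complements of the bases of \<^term>\<open>M\<close>, so its
  independent sets are the sets that avoid some basis of \<^term>\<open>M\<close>.\<close>

definition dual :: "'a pre_matroid \<Rightarrow> 'a pre_matroid" where
  "dual M = \<lparr>ground = ground M, indep = {I. I \<subseteq> ground M \<and> (\<exists>B \<in> bases M. I \<inter> B = {})}\<rparr>"

definition contract :: "'a pre_matroid \<Rightarrow> 'a set \<Rightarrow> 'a pre_matroid" where
  "contract M X = dual (delete (dual M) X)"

text \<open>The direct sum of \<^term>\<open>M\<close> with a copy of $U_{1,1}$ on \<open>{x}\<close>.\<close>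

definition add_coloop :: "'a pre_matroid \<Rightarrow> 'a \<Rightarrow> 'a pre_matroid" where
  "add_coloop M x =
    \<lparr>ground = insert x (ground M), indep = {I \<union> J | I J. I \<in> indep M \<and> J \<subseteq> {x}}\<rparr>"

definition principal_extension ::
  "'a pre_matroid \<Rightarrow> 'a set \<Rightarrow> 'a \<Rightarrow> 'a pre_matroid \<Rightarrow> bool" where
  "principal_extension M F x M' \<longleftrightarrow>
    flat M F \<and> x \<notin> ground M \<and>
    matroid M' \<and> ground M' = insert x (ground M) \<and> delete M' {x} = M \<and>
    (\<forall>X \<subseteq> ground M. spans M' X {x} \<longleftrightarrow> spans M X F)"

section \<open>Matroids constructed from the empty matroid\<close>

inductive U00_constructed_on :: "'a pre_matroid \<Rightarrow> bool" where
  empty: "U00_constructed_on empty_matroid"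
| relabel: "U00_constructed_on M \<Longrightarrow> inj_on f (ground M) \<Longrightarrow> U00_constructed_on (relabel f M)"
| delete: "U00_constructed_on M \<Longrightarrow> X \<subseteq> ground M \<Longrightarrow> U00_constructed_on (delete M X)"
| contract: "U00_constructed_on M \<Longrightarrow> X \<subseteq> ground M \<Longrightarrow> U00_constructed_on (contract M X)"
| add_coloop: "U00_constructed_on M \<Longrightarrow> x \<notin> ground M \<Longrightarrow> U00_constructed_on (add_coloop M x)"
| principal_extension:
    "U00_constructed_on M \<Longrightarrow> principal_extension M F x M' \<Longrightarrow> U00_constructed_on M'"

text \<open>The intermediate matroids may need more elements than the type \<^typ>\<open>'a\<close> has (it may be
  finite), so the construction takes place over \<^typ>\<open>nat\<close> and ends with a relabelling into
  \<^typ>\<open>'a\<close>. Since every matroid in a construction is finite and may be relabelled, \<^typ>\<open>nat\<close>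
  is large enough.\<close>

definition U00_constructed :: "'a pre_matroid \<Rightarrow> bool" where
  "U00_constructed M \<longleftrightarrow>
    (\<exists>(N :: nat pre_matroid) f. U00_constructed_on N \<and> inj_on f (ground N) \<and> M = relabel f N)"

section \<open>Gammoids\<close>

text \<open>\<^term>\<open>X\<close> is linked to \<^term>\<open>Y\<close> if there are pairwise vertex-disjoint paths with set of
  initial vertices \<^term>\<open>X\<close> and set of terminal vertices \<^term>\<open>Y\<close>. A path may consist of a
  single vertex; disjointness forces \<^term>\<open>card X = card Y\<close>.\<close>

definition linked :: "('v, 'e) pre_digraph \<Rightarrow> 'v set \<Rightarrow> 'v set \<Rightarrow> bool" where
  "linked D X Y \<longleftrightarrow>
    (\<exists>P. (\<forall>p \<in> P. vpath p D) \<and> (\<forall>p \<in> P. \<forall>q \<in> P. p \<noteq> q \<longrightarrow> set p \<inter> set q = {}) \<and>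
      hd ` P = X \<and> last ` P = Y)"

definition strict_gammoid :: "('v, 'e) pre_digraph \<Rightarrow> 'v set \<Rightarrow> 'v pre_matroid" where
  "strict_gammoid D B = \<lparr>ground = verts D, indep = {X. \<exists>Y \<subseteq> B. linked D X Y}\<rparr>"

text \<open>A gammoid is a matroid isomorphic to a restriction of a strict gammoid. The digraph may need
  more vertices than \<^typ>\<open>'a\<close> has elements; up to isomorphism, every finite digraph has
  vertices in \<^typ>\<open>nat\<close> and arcs in \<^typ>\<open>nat \<times> nat\<close>.\<close>

definition gammoid :: "'a pre_matroid \<Rightarrow> bool" where
  "gammoid M \<longleftrightarrow>
    (\<exists>(D :: (nat, nat \<times> nat) pre_digraph) B X f.
      fin_digraph D \<and> B \<subseteq> verts D \<and> X \<subseteq> verts D \<and> inj_on f X \<and>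
      M = relabel f (restrict (strict_gammoid D B) X))"

end

theory Submission
  imports Defs
begin

text \<open>Both classes consist of the matroids whose independent sets are the sets \<open>X\<close> for which a
  fixed finite set family \<open>A w\<close>, \<open>w \<in> W\<close>, has a system of distinct representatives avoiding
  \<open>X\<close> (restrictions of duals of transversal matroids). By Ingleton and Piff, \<open>X\<close> is linked into
  \<open>B\<close> in a digraph iff the family of the out-stars of the vertices outside \<open>B\<close> has such a system.
  Adding a set \<open>A w\<close> to the family is the same as adding an element freely to \<open>A w\<close> and
  contracting it, so these matroids are built from free matroids by principal extensions and
  minors. Conversely, the presentation survives every operation: contracting \<open>C\<close> removes a basis
  of \<open>C\<close> from all \<open>A w\<close>, and a principal extension by \<open>x\<close> into \<open>F\<close> adds the set \<open>F \<union> {x}\<close>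
  to the family.\<close>

section \<open>Bases of subsets and closure\<close>

text \<open>Maximality is tested one element at a time, which suffices in a matroid because
  independence is hereditary.\<close>

definition basis_of :: "'a pre_matroid \<Rightarrow> 'a set \<Rightarrow> 'a set \<Rightarrow> bool" where
  "basis_of M I X \<longleftrightarrow> I \<in> indep M \<and> I \<subseteq> X \<and> (\<forall>e \<in> X - I. insert e I \<notin> indep M)"

context matroid
begin

lemma indep_finite: "I \<in> indep M \<Longrightarrow> finite I"
  using finite_ground indep_subset_ground finite_subset by blast

lemma card_le_basis_of:
  assumes "basis_of M I X" "J \<in> indep M" "J \<subseteq> X"
  shows "card J \<le> card I"
proof (rule ccontr)
  assume "\<not> card J \<le> card I"
  then obtain e where "e \<in> J - I" "insert e I \<in> indep M"
    using indep_augment[of I J] assms by (auto simp: basis_of_def)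
  then show False using assms by (auto simp: basis_of_def)
qed

lemma basis_of_if_card_le:
  assumes "basis_of M I X" "J \<in> indep M" "J \<subseteq> X" "card I \<le> card J"
  shows "basis_of M J X"
proof -
  have "insert e J \<notin> indep M" if "e \<in> X - J" for e
  proof
    assume "insert e J \<in> indep M"
    then have "card (insert e J) \<le> card I"
      using card_le_basis_of[OF assms(1)] that assms(3) by blast
    then show False using that assms indep_finite[OF assms(2)] by simp
  qed
  then show ?thesis using assms by (auto simp: basis_of_def)
qed

lemma card_basis_of_eq: "basis_of M I X \<Longrightarrow> basis_of M J X \<Longrightarrow> card I = card J"
  by (meson basis_of_def card_le_basis_of le_antisym)

lemma basis_of_extend:
  assumes "I \<in> indep M" "I \<subseteq> X"
  obtains J where "basis_of M J X" "I \<subseteq> J"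
proof -
  let ?S = "{J \<in> indep M. I \<subseteq> J \<and> J \<subseteq> X}"
  have fin: "finite ?S"
    by (rule finite_subset[of _ "Pow (ground M)"])
       (use finite_ground indep_subset_ground in auto)
  have "I \<in> ?S" using assms by auto
  then obtain J where J: "J \<in> ?S" "\<And>K. K \<in> ?S \<Longrightarrow> J \<subseteq> K \<Longrightarrow> K = J"
    using finite_has_maximal[OF fin] by (metis (lifting) empty_iff)
  have "basis_of M J X"
    unfolding basis_of_def
  proof (intro conjI ballI notI)
    fix e assume e: "e \<in> X - J" "insert e J \<in> indep M"
    then have "insert e J \<in> ?S" using J(1) by auto
    then show False using J(2)[of "insert e J"] e(1) by blast
  qed (use J in auto)
  then show ?thesis using that J by auto
qed

lemma basis_of_exists: obtains I where "basis_of M I X"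
  using basis_of_extend[OF indep_empty, of X] by auto

lemma rank_eq_card_basis_of:
  assumes "basis_of M I X"
  shows "rank M X = card I"
  unfolding rank_def
proof (rule Max_eqI)
  have "finite {I \<in> indep M. I \<subseteq> X}"
    by (rule finite_subset[of _ "Pow (ground M)"])
       (use finite_ground indep_subset_ground in auto)
  then show "finite (card ` {I \<in> indep M. I \<subseteq> X})" by simp
  show "card I \<in> card ` {I \<in> indep M. I \<subseteq> X}" using assms by (auto simp: basis_of_def)
qed (use card_le_basis_of[OF assms] in auto)

text \<open>Trades ranks for independence: if \<open>e\<close> cannot enlarge \<open>I\<close>, then
  \<open>I\<close> is still a basis of \<open>insert e X\<close>; otherwise
  \<open>insert e I\<close> extends to a basis of \<open>insert e X\<close> that is larger than
  \<open>I\<close>.\<close>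

lemma mem_cl_iff:
  assumes "basis_of M I X"
  shows "e \<in> cl M X \<longleftrightarrow> e \<in> ground M \<and> (e \<in> I \<or> insert e I \<notin> indep M)"
proof (cases "e \<in> I \<or> insert e I \<notin> indep M")
  case True
  then have "basis_of M I (insert e X)" using assms by (auto simp: basis_of_def)
  then show ?thesis
    using True rank_eq_card_basis_of[OF assms] rank_eq_card_basis_of by (auto simp: cl_def)
next
  case False
  then obtain J where J: "basis_of M J (insert e X)" "insert e I \<subseteq> J"
    using basis_of_extend[of "insert e I" "insert e X"] assms by (auto simp: basis_of_def)
  have "card I < card (insert e I)"
    using False indep_finite[of I] assms by (simp add: basis_of_def)
  also have "\<dots> \<le> card J"
    using J by (auto intro!: card_mono indep_finite simp: basis_of_def)
  finally show ?thesis
    using False rank_eq_card_basis_of[OF assms] rank_eq_card_basis_of[OF J(1)]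
    by (auto simp: cl_def)
qed

lemma mem_cl_indep_iff:
  assumes "I \<in> indep M"
  shows "e \<in> cl M I \<longleftrightarrow> e \<in> ground M \<and> (e \<in> I \<or> insert e I \<notin> indep M)"
  using assms by (intro mem_cl_iff) (auto simp: basis_of_def)

lemma subset_cl: "X \<subseteq> ground M \<Longrightarrow> X \<subseteq> cl M X"
  by (auto simp: cl_def insert_absorb)

lemma cl_mono:
  assumes "X \<subseteq> Y"
  shows "cl M X \<subseteq> cl M Y"
proof
  fix e assume e: "e \<in> cl M X"
  obtain I where I: "basis_of M I X" by (rule basis_of_exists)
  then obtain J where J: "basis_of M J Y" "I \<subseteq> J"
    using basis_of_extend[of I Y] assms by (auto simp: basis_of_def)
  have "insert e J \<in> indep M \<Longrightarrow> insert e I \<in> indep M"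
    using J indep_subset[of "insert e J" "insert e I"] by auto
  then show "e \<in> cl M Y"
    using e J unfolding mem_cl_iff[OF I] mem_cl_iff[OF J(1)] by auto
qed

text \<open>A basis of \<open>X\<close> is also a basis of \<open>cl M X\<close>, and by
  \<open>mem_cl_iff\<close> a closure can be computed from any such basis.\<close>

lemma cl_idem:
  assumes "X \<subseteq> ground M"
  shows "cl M (cl M X) = cl M X"
proof -
  obtain I where I: "basis_of M I X" by (rule basis_of_exists)
  then have "basis_of M I (cl M X)"
    using subset_cl[OF assms] mem_cl_iff[OF I] by (auto simp: basis_of_def)
  then show ?thesis using mem_cl_iff[OF I] mem_cl_iff by auto
qed

lemma flat_cl: "X \<subseteq> ground M \<Longrightarrow> flat M (cl M X)"
  by (auto simp: flat_def cl_idem) (auto simp: cl_def)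

text \<open>Lets a generating set stand in for the flat of a principal extension.\<close>

lemma spans_cl_iff:
  assumes "X \<subseteq> ground M" "Y \<subseteq> ground M"
  shows "spans M X (cl M Y) \<longleftrightarrow> spans M X Y"
  using subset_cl[OF assms(2)] cl_mono[of Y "cl M X"] cl_idem[OF assms(1)]
  by (auto simp: spans_def)

lemma basis_of_ground_iff: "basis_of M B (ground M) \<longleftrightarrow> B \<in> bases M"
proof
  assume B: "basis_of M B (ground M)"
  have "I = B" if I: "I \<in> indep M" "B \<subseteq> I" for I
  proof (rule ccontr)
    assume "I \<noteq> B"
    then obtain e where "e \<in> I - B" using I by auto
    then show False
      using B I indep_subset[of I "insert e B"] indep_subset_ground[of I]
      by (auto simp: basis_of_def)
  qed
  then show "B \<in> bases M" using B by (auto simp: bases_def basis_of_def)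
next
  assume "B \<in> bases M"
  then show "basis_of M B (ground M)"
    using indep_subset_ground by (auto simp: basis_of_def bases_def)
qed

section \<open>Contraction\<close>

lemma ground_contract: "ground (contract M C) = ground M - C"
  by (simp add: contract_def dual_def delete_def)

text \<open>Resolves the double dual. The bases of \<open>delete (dual M) C\<close> are the sets
  \<open>ground M - C - B\<close> for those bases \<open>B\<close> of \<open>M\<close> that meet
  \<open>C\<close> in a basis of \<open>C\<close>. Which basis \<open>Y\<close> of \<open>C\<close>
  is used is immaterial, by exchange.\<close>

lemma indep_contract_iff:
  assumes C: "C \<subseteq> ground M" and Y: "basis_of M Y C"
  shows "X \<in> indep (contract M C) \<longleftrightarrow> X \<subseteq> ground M - C \<and> X \<union> Y \<in> indep M"
proof -
  let ?E = "ground M"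
  let ?S = "{Z. Z \<subseteq> ?E - C \<and> (\<exists>B \<in> bases M. Z \<inter> B = {})}"
  have YC: "Y \<subseteq> C" "Y \<in> indep M" using Y by (auto simp: basis_of_def)
  have S: "indep (delete (dual M) C) = ?S" and E: "ground (delete (dual M) C) = ?E - C"
    by (auto simp: delete_def dual_def)
  have "X \<in> indep (contract M C) \<longleftrightarrow>
      X \<subseteq> ?E - C \<and> (\<exists>Z \<in> ?S. (\<forall>Z' \<in> ?S. Z \<subseteq> Z' \<longrightarrow> Z' = Z) \<and> X \<inter> Z = {})"
    unfolding contract_def dual_def[of "delete _ _"] bases_def[of "delete _ _"] S E by auto
  also have "\<dots> \<longleftrightarrow> X \<subseteq> ?E - C \<and> X \<union> Y \<in> indep M"
  proof (intro conj_cong refl iffI)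
    assume XE: "X \<subseteq> ?E - C" and "X \<union> Y \<in> indep M"
    then obtain B where B: "basis_of M B ?E" "X \<union> Y \<subseteq> B"
      using basis_of_extend[of "X \<union> Y" ?E] indep_subset_ground by metis
    have finB: "finite B" using B indep_finite by (auto simp: basis_of_def)
    have BC: "B \<inter> C = Y"
    proof (rule ccontr)
      assume "B \<inter> C \<noteq> Y"
      then obtain e where "e \<in> C - Y" "e \<in> B" using B YC by auto
      moreover have "insert e Y \<in> indep M"
        using B \<open>e \<in> B\<close> indep_subset[of B "insert e Y"] by (auto simp: basis_of_def)
      ultimately show False using Y by (auto simp: basis_of_def)
    qed
    let ?Z = "?E - C - B"
    have "Z' = ?Z" if Z': "Z' \<in> ?S" "?Z \<subseteq> Z'" for Z'
    proof -
      obtain B' where B': "basis_of M B' ?E" "Z' \<inter> B' = {}"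
        using Z' basis_of_ground_iff by auto
      have B'E: "B' \<subseteq> ?E" "B' \<in> indep M" using B' by (auto simp: basis_of_def)
      have finB': "finite B'" using indep_finite B'E by auto
      have "card (B' \<inter> C) \<le> card Y"
        using card_le_basis_of[OF Y] indep_subset[OF B'E(2)] by auto
      moreover have "card B' = card B" using card_basis_of_eq[OF B'(1) B(1)] .
      moreover have "card B' = card (B' \<inter> C) + card (B' - C)"
        using finB' by (metis Int_commute card_Diff_subset_Int card_Int_Diff)
      moreover have "card B = card Y + card (B - C)"
        using finB BC card_Int_Diff[of B C] by simp
      ultimately have "card (B - C) \<le> card (B' - C)" by linarith
      moreover have "B' - C \<subseteq> B - C" using Z' B' B'E by auto
      ultimately have "B' - C = B - C"
        using finB by (simp add: card_seteq)
      then show ?thesis using Z' B' by auto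
    qed
    moreover have "?Z \<in> ?S" using B basis_of_ground_iff by auto
    ultimately show "\<exists>Z \<in> ?S. (\<forall>Z' \<in> ?S. Z \<subseteq> Z' \<longrightarrow> Z' = Z) \<and> X \<inter> Z = {}"
      using B by (intro bexI[of _ ?Z]) auto
  next
    assume XE: "X \<subseteq> ?E - C" and
      "\<exists>Z \<in> ?S. (\<forall>Z' \<in> ?S. Z \<subseteq> Z' \<longrightarrow> Z' = Z) \<and> X \<inter> Z = {}"
    then obtain Z B' where Z: "Z \<subseteq> ?E - C" "\<And>Z'. Z' \<in> ?S \<Longrightarrow> Z \<subseteq> Z' \<Longrightarrow> Z' = Z"
        "X \<inter> Z = {}" and B': "basis_of M B' ?E" "Z \<inter> B' = {}"
      using basis_of_ground_iff by auto
    \<comment> \<open>Trades the part of \<open>B'\<close> inside \<open>C\<close> for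
      \<open>Y\<close>. Since \<open>B - C\<close> stays inside \<open>B'\<close>, the complement of
      \<open>B\<close> outside \<open>C\<close> contains \<open>Z\<close>, and maximality of
      \<open>Z\<close> gives equality.\<close>
    obtain B where B: "basis_of M B (B' \<union> C)" "Y \<subseteq> B"
      using basis_of_extend[of Y "B' \<union> C"] YC by auto
    have "basis_of M B' (B' \<union> C)" using B' C by (auto simp: basis_of_def)
    then have "card B' = card B" using card_basis_of_eq B by blast
    then have BB: "basis_of M B ?E"
      using B(1) B'(1) C by (intro basis_of_if_card_le[OF B'(1)]) (auto simp: basis_of_def)
    then have "?E - C - B \<in> ?S" using basis_of_ground_iff by auto
    moreover have "Z \<subseteq> ?E - C - B" using B B' Z by (auto simp: basis_of_def)
    ultimately have "?E - C - B = Z" using Z(2) by blast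
    then have "X \<union> Y \<subseteq> B" using Z XE B by auto
    then show "X \<union> Y \<in> indep M" using BB indep_subset by (auto simp: basis_of_def)
  qed
  finally show ?thesis .
qed

text \<open>Adjoining a fixed basis \<open>Y\<close> of \<open>C\<close> adds \<open>card Y\<close>
  to every cardinality, so augmentation is inherited from \<open>M\<close>.\<close>

lemma matroid_contract:
  assumes C: "C \<subseteq> ground M"
  shows "matroid (contract M C)"
proof -
  obtain Y where Y: "basis_of M Y C" by (rule basis_of_exists)
  note ind = indep_contract_iff[OF C Y]
  have YC: "Y \<subseteq> C" "Y \<in> indep M" using Y by (auto simp: basis_of_def)
  show ?thesis
  proof
    fix I J assume IJ: "I \<in> indep (contract M C)" "J \<in> indep (contract M C)" "card I < card J"
    have I: "I \<subseteq> ground M - C" "I \<union> Y \<in> indep M" and J: "J \<subseteq> ground M - C" "J \<union> Y \<in> indep M"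
      using IJ ind by auto
    have "card (I \<union> Y) = card I + card Y"
      using I YC indep_finite[OF I(2)] by (intro card_Un_disjoint) auto
    moreover have "card (J \<union> Y) = card J + card Y"
      using J YC indep_finite[OF J(2)] by (intro card_Un_disjoint) auto
    ultimately obtain e where "e \<in> J \<union> Y - (I \<union> Y)" "insert e (I \<union> Y) \<in> indep M"
      using indep_augment[OF I(2) J(2)] IJ(3) by auto
    then show "\<exists>e \<in> J - I. insert e I \<in> indep (contract M C)"
      using I J ind by auto
  next
    fix I J assume "I \<in> indep (contract M C)" "J \<subseteq> I"
    then show "J \<in> indep (contract M C)"
      unfolding ind using indep_subset[of "I \<union> Y" "J \<union> Y"] by auto
  qed (use finite_ground YC ind in \<open>auto simp: ground_contract\<close>)
qed

section \<open>Deletion, coloops and relabelling\<close>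

lemma matroid_delete: "matroid (delete M X)"
proof
  fix I J assume "I \<in> indep (delete M X)" "J \<in> indep (delete M X)" "card I < card J"
  then show "\<exists>e \<in> J - I. insert e I \<in> indep (delete M X)"
    using indep_augment[of I J] by (fastforce simp: delete_def)
qed (use finite_ground indep_subset_ground indep_empty indep_subset in
      \<open>auto simp: delete_def\<close>)

end

lemma indep_add_coloop_iff:
  assumes "x \<notin> ground M" "matroid M"
  shows "X \<in> indep (add_coloop M x) \<longleftrightarrow> X - {x} \<in> indep M"
proof
  assume "X \<in> indep (add_coloop M x)"
  then obtain I J where "X = I \<union> J" "I \<in> indep M" "J \<subseteq> {x}" by (auto simp: add_coloop_def)
  then show "X - {x} \<in> indep M"
    using matroid.indep_subset[OF assms(2), of I "X - {x}"] by auto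
next
  assume "X - {x} \<in> indep M"
  moreover have "X = (X - {x}) \<union> (X \<inter> {x})" "X \<inter> {x} \<subseteq> {x}" by auto
  ultimately show "X \<in> indep (add_coloop M x)"
    unfolding add_coloop_def by (simp, blast)
qed

lemma matroid_add_coloop:
  assumes "matroid M" "x \<notin> ground M"
  shows "matroid (add_coloop M x)"
proof -
  interpret matroid M by fact
  note ind = indep_add_coloop_iff[OF assms(2,1)]
  show ?thesis
  proof
    fix I J assume IJ: "I \<in> indep (add_coloop M x)" "J \<in> indep (add_coloop M x)" "card I < card J"
    have fin: "finite I" "finite J" using IJ ind indep_finite by fastforce+
    show "\<exists>e \<in> J - I. insert e I \<in> indep (add_coloop M x)"
    proof (cases "x \<in> J - I")
      case True
      then show ?thesis using IJ ind by (intro bexI[of _ x]) auto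
    next
      case False
      \<comment> \<open>Here \<open>x\<close> in \<open>J\<close> implies \<open>x\<close> in
        \<open>I\<close>, so removing \<open>x\<close> lowers \<open>card I\<close> at least as much
        as \<open>card J\<close>; positivity guards the subtraction on \<open>nat\<close>.\<close>
      have "x \<in> I \<Longrightarrow> card I > 0" using fin by (auto simp: card_gt_0_iff)
      then have "card (I - {x}) < card (J - {x})"
        using False IJ(3) fin by (cases "x \<in> I") (auto simp: card_Diff_singleton_if)
      then obtain e where e: "e \<in> J - {x} - (I - {x})" "insert e (I - {x}) \<in> indep M"
        using indep_augment[of "I - {x}" "J - {x}"] IJ ind by auto
      then have "insert e I - {x} = insert e (I - {x})" by auto
      then show ?thesis using e ind[of "insert e I"] by (intro bexI[of _ e]) auto
    qed
  next
    fix I assume "I \<in> indep (add_coloop M x)"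
    then show "I \<subseteq> ground (add_coloop M x)"
      using ind indep_subset_ground[of "I - {x}"] by (auto simp: add_coloop_def)
  next
    fix I J assume "I \<in> indep (add_coloop M x)" "J \<subseteq> I"
    then show "J \<in> indep (add_coloop M x)"
      using ind indep_subset[of "I - {x}" "J - {x}"] by auto
  qed (use finite_ground indep_empty ind in \<open>auto simp: add_coloop_def\<close>)
qed

lemma matroid_relabel:
  assumes "matroid M" and inj: "inj_on f (ground M)"
  shows "matroid (relabel f M)"
proof -
  interpret matroid M by fact
  have card_image_indep: "card (f ` I) = card I" if "I \<in> indep M" for I
    using inj indep_subset_ground[OF that] by (meson card_image inj_on_subset)
  show ?thesis
  proof
    fix I J assume "I \<in> indep (relabel f M)" "J \<in> indep (relabel f M)" "card I < card J"
    then obtain I' J' where I': "I = f ` I'" "I' \<in> indep M" and J': "J = f ` J'" "J' \<in> indep M"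
      and "card I' < card J'"
      using card_image_indep by (auto simp: relabel_def)
    then obtain e where e: "e \<in> J' - I'" "insert e I' \<in> indep M" using indep_augment by blast
    have "f e \<notin> I"
      using e I' J' inj indep_subset_ground[of I'] indep_subset_ground[of J']
      by (auto dest: inj_onD)
    then show "\<exists>e \<in> J - I. insert e I \<in> indep (relabel f M)"
      using e I' J' by (intro bexI[of _ "f e"])
        (auto simp: relabel_def image_iff intro!: bexI[of _ "insert e I'"])
  next
    fix I J assume "I \<in> indep (relabel f M)" "J \<subseteq> I"
    then obtain I' where "I' \<in> indep M" "J \<subseteq> f ` I'" by (auto simp: relabel_def)
    then obtain J' where "J' \<subseteq> I'" "J = f ` J'" by (auto simp: subset_image_iff)
    then show "J \<in> indep (relabel f M)"
      using indep_subset \<open>I' \<in> indep M\<close> by (auto simp: relabel_def)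
  qed (use finite_ground indep_empty indep_subset_ground in \<open>force simp: relabel_def\<close>)+
qed

lemma matroid_empty_matroid: "matroid empty_matroid"
  by unfold_locales (auto simp: empty_matroid_def)

lemma matroid_U00_constructed_on: "U00_constructed_on M \<Longrightarrow> matroid M"
  by (induction rule: U00_constructed_on.induct)
    (auto simp: matroid_empty_matroid matroid_relabel matroid.matroid_delete
      matroid.matroid_contract matroid_add_coloop principal_extension_def)

section \<open>Principal extensions\<close>

text \<open>For independent \<open>I\<close>, adding \<open>x\<close> creates a dependency iff
  \<open>I\<close> spans \<open>x\<close>, hence iff \<open>I\<close> spans \<open>F\<close>. So
  \<open>x\<close> can be added exactly when some element of \<open>F\<close> can.\<close>

lemma principal_extension_indep_iff:
  assumes "matroid M" and "principal_extension M F x M'"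
  shows "X \<in> indep M' \<longleftrightarrow>
    (if x \<in> X then X - {x} \<in> indep M \<and> (\<exists>f \<in> F - X. insert f (X - {x}) \<in> indep M)
     else X \<in> indep M)"
proof -
  interpret matroid M by fact
  have F: "flat M F" "x \<notin> ground M" and "matroid M'" and G: "ground M' = insert x (ground M)"
    and D: "delete M' {x} = M"
    and S: "\<And>X. X \<subseteq> ground M \<Longrightarrow> spans M' X {x} \<longleftrightarrow> spans M X F"
    using assms(2) by (auto simp: principal_extension_def)
  interpret M': matroid M' by fact
  have del: "I \<in> indep M \<longleftrightarrow> I \<in> indep M' \<and> x \<notin> I" for I
    unfolding D[symmetric] by (auto simp: delete_def)
  have FE: "F \<subseteq> ground M" using F by (simp add: flat_def)
  have ins: "insert x I \<in> indep M' \<longleftrightarrow> (\<exists>f \<in> F - I. insert f I \<in> indep M)"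
    if I: "I \<in> indep M" for I
  proof -
    have I': "I \<in> indep M'" "x \<notin> I" "I \<subseteq> ground M" using I del indep_subset_ground by auto
    have "insert x I \<in> indep M' \<longleftrightarrow> \<not> spans M' I {x}"
      using M'.mem_cl_indep_iff[OF I'(1), of x] I' G by (simp add: spans_def)
    also have "\<dots> \<longleftrightarrow> \<not> F \<subseteq> cl M I" using S I' by (simp add: spans_def)
    also have "\<dots> \<longleftrightarrow> (\<exists>f \<in> F - I. insert f I \<in> indep M)"
      using mem_cl_indep_iff[OF I] FE by auto
    finally show ?thesis .
  qed
  show ?thesis
  proof (cases "x \<in> X")
    case True
    have "X \<in> indep M' \<Longrightarrow> X - {x} \<in> indep M"
      using M'.indep_subset[of X "X - {x}"] del by auto
    moreover have "F - X = F - (X - {x})" using FE F(2) by auto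
    ultimately show ?thesis using ins[of "X - {x}"] True by (auto simp: insert_absorb)
  qed (use del in auto)
qed

section \<open>Existence of principal extensions\<close>

definition free_extension :: "'a pre_matroid \<Rightarrow> 'a set \<Rightarrow> 'a \<Rightarrow> 'a pre_matroid" where
  "free_extension M F x = \<lparr>ground = insert x (ground M),
     indep = indep M \<union> {insert x I | I. I \<in> indep M \<and> (\<exists>f \<in> F - I. insert f I \<in> indep M)}\<rparr>"

context matroid
begin

context
  fixes F :: "'a set" and x :: 'a
  assumes x_notin_ground: "x \<notin> ground M"
begin

lemma indep_free_extension_cases:
  assumes "I \<in> indep (free_extension M F x)"
  obtains "I \<in> indep M" "x \<notin> I"
    | I' f where "I = insert x I'" "x \<notin> I'" "I' \<in> indep M" "f \<in> F" "f \<notin> I'" "insert f I' \<in> indep M"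
proof -
  have notin: "x \<notin> K" if "K \<in> indep M" for K
    using indep_subset_ground[OF that] x_notin_ground by auto
  show thesis
  proof (cases "I \<in> indep M")
    case True
    then show ?thesis using that(1) notin by blast
  next
    case False
    then obtain K f where "I = insert x K" "K \<in> indep M" "f \<in> F - K" "insert f K \<in> indep M"
      using assms by (auto simp: free_extension_def)
    then show ?thesis using that(2)[of K f] notin by blast
  qed
qed

lemma insert_indep_free_extension:
  assumes "f \<in> F" "f \<notin> I" "insert f I \<in> indep M"
  shows "insert x I \<in> indep (free_extension M F x)"
  using assms indep_subset[of "insert f I" I] by (auto simp: free_extension_def)

lemma indep_indep_free_extension: "I \<in> indep M \<Longrightarrow> I \<in> indep (free_extension M F x)"
  by (simp add: free_extension_def)

lemma insert_indep_free_extension_iff: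
  assumes "x \<notin> I"
  shows "insert x I \<in> indep (free_extension M F x) \<longleftrightarrow> (\<exists>f \<in> F - I. insert f I \<in> indep M)"
proof
  assume "insert x I \<in> indep (free_extension M F x)"
  then show "\<exists>f \<in> F - I. insert f I \<in> indep M"
    using assms by (cases rule: indep_free_extension_cases) (auto dest: insert_ident)
qed (use insert_indep_free_extension in auto)

text \<open>An independent set containing \<open>x\<close> is represented in \<open>M\<close> by a
  set of the same size with some element of \<open>F\<close> in place of \<open>x\<close>.
  Augmentation takes place between these representatives and is translated back.\<close>

lemma matroid_free_extension: "matroid (free_extension M F x)"
proof
  let ?N = "free_extension M F x"
  note free_intros = insert_indep_free_extension indep_indep_free_extension
  fix I J assume I: "I \<in> indep ?N" and J: "J \<in> indep ?N" and less: "card I < card J"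
  from I show "\<exists>e \<in> J - I. insert e I \<in> indep ?N"
  proof (cases rule: indep_free_extension_cases)
    case I: 1
    from J show ?thesis
    proof (cases rule: indep_free_extension_cases)
      case 1
      then show ?thesis using indep_augment[OF I(1), of J] less free_intros by blast
    next
      case J: (2 J' g)
      have "card J = card (insert g J')" using J indep_finite by simp
      then obtain e where e: "e \<in> insert g J' - I" "insert e I \<in> indep M"
        using indep_augment[OF I(1) J(6)] less by auto
      show ?thesis
      proof (cases "e \<in> J'")
        case True
        then show ?thesis using e J free_intros(2) by (intro bexI[of _ e]) auto
      next
        case False
        \<comment> \<open>The new element is \<open>g\<close>; as it lies in \<open>F\<close>, the
          element \<open>x\<close> of \<open>J\<close> can be added instead.\<close>
        then show ?thesis using e J I free_intros(1)[of g I] by (intro bexI[of _ x]) auto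
      qed
    qed
  next
    case I: (2 I' f)
    have cI: "card I = card (insert f I')" using I indep_finite by simp
    have swap: "insert e I \<in> indep ?N"
      if "h \<in> F" "h \<notin> insert e I'" "insert h (insert e I') \<in> indep M" for e h
      using free_intros(1)[OF that] I by (simp add: insert_commute)
    from J show ?thesis
    proof (cases rule: indep_free_extension_cases)
      case J: 1
      then obtain e where e: "e \<in> J - insert f I'" "insert e (insert f I') \<in> indep M"
        using indep_augment[OF I(6), of J] less cI by auto
      then show ?thesis
        using swap[of f e] I J by (intro bexI[of _ e]) (auto simp: insert_commute)
    next
      case J: (2 J' g)
      have cJ: "card J = card (insert g J')" using J indep_finite by simp
      obtain e where e: "e \<in> insert g J' - insert f I'" "insert e (insert f I') \<in> indep M"
        using indep_augment[OF I(6) J(6)] less cI cJ by auto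
      show ?thesis
      proof (cases "e \<in> J'")
        case True
        then show ?thesis
          using e swap[of f e] I J by (intro bexI[of _ e]) (auto simp: insert_commute)
      next
        case False
        then have eg: "e = g" "g \<notin> insert f I'" using e by auto
        \<comment> \<open>Now \<open>g\<close> is of no use, since \<open>x\<close> already lies in
          \<open>I\<close>. Some \<open>d\<close> of \<open>J'\<close> enlarges \<open>I'\<close>,
          and comparison with \<open>insert g (insert f I')\<close> gives an \<open>h\<close> that
          must be \<open>f\<close> or \<open>g\<close>, hence a member of \<open>F\<close> that
          makes room for \<open>x\<close>.\<close>
        have "card I' < card J'" using less I J indep_finite by simp
        then obtain d where d: "d \<in> J' - I'" "insert d I' \<in> indep M"
          using indep_augment I J by blast
        have "card (insert d I') < card (insert g (insert f I'))"
          using d eg I indep_finite by simp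
        then obtain h where "h \<in> insert g (insert f I') - insert d I'"
            "insert h (insert d I') \<in> indep M"
          using indep_augment[OF d(2)] e eg by blast
        then have "insert d I \<in> indep ?N" using swap[of h d] I J by auto
        then show ?thesis using d I J by (intro bexI[of _ d]) auto
      qed
    qed
  qed
next
  fix I J assume "I \<in> indep (free_extension M F x)" and JI: "J \<subseteq> I"
  then show "J \<in> indep (free_extension M F x)"
  proof (cases rule: indep_free_extension_cases)
    case 1
    then show ?thesis using JI indep_subset indep_indep_free_extension by blast
  next
    case (2 I' f)
    show ?thesis
    proof (cases "x \<in> J")
      case True
      then have "insert f (J - {x}) \<in> indep M" "f \<notin> J - {x}"
        using 2 JI indep_subset[of "insert f I'" "insert f (J - {x})"] by auto
      then show ?thesis
        using insert_indep_free_extension[OF 2(4)] True by (metis insert_Diff)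
    next
      case False
      then show ?thesis
        using 2 JI indep_subset[of I' J] indep_indep_free_extension by blast
    qed
  qed
qed (use finite_ground indep_subset_ground indep_empty in \<open>auto simp: free_extension_def\<close>)

lemma delete_free_extension: "delete (free_extension M F x) {x} = M"
proof -
  have "x \<notin> I" if "I \<in> indep M" for I
    using indep_subset_ground[OF that] x_notin_ground by auto
  then show ?thesis
    using x_notin_ground
    by (auto simp: delete_def free_extension_def intro!: pre_matroid.equality)
qed

text \<open>Supplies a principal extension for an arbitrary generating set. A basis \<open>I\<close>
  of \<open>X\<close> in \<open>M\<close> is still one in the extension because \<open>X\<close>
  avoids \<open>x\<close>, so both spanning conditions can be tested on \<open>I\<close>.\<close>

lemma principal_extension_free_extension:
  assumes F: "F \<subseteq> ground M"
  shows "principal_extension M (cl M F) x (free_extension M F x)"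
proof -
  let ?N = "free_extension M F x"
  interpret N: matroid ?N by (rule matroid_free_extension)
  have "spans ?N X {x} \<longleftrightarrow> spans M X (cl M F)" if X: "X \<subseteq> ground M" for X
  proof -
    obtain I where I: "basis_of M I X" by (rule basis_of_exists)
    then have IM: "I \<in> indep M" "x \<notin> I"
      using x_notin_ground indep_subset_ground by (auto simp: basis_of_def)
    have xX: "x \<notin> X" using X x_notin_ground by auto
    have in_M: "J \<in> indep ?N \<longleftrightarrow> J \<in> indep M" if "x \<notin> J" for J
      using that by (auto simp: free_extension_def)
    have "insert e I \<in> indep ?N \<longleftrightarrow> insert e I \<in> indep M" if "e \<in> X" for e
      using that xX IM by (intro in_M) auto
    then have IN: "basis_of ?N I X"
      using I in_M IM by (auto simp: basis_of_def)
    have "spans ?N X {x} \<longleftrightarrow> spans M X F"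
      using N.mem_cl_iff[OF IN, of x] mem_cl_iff[OF I] F IM
        insert_indep_free_extension_iff[OF IM(2)]
      by (auto simp: spans_def free_extension_def)
    then show ?thesis using spans_cl_iff[OF X F] by simp
  qed
  then show ?thesis
    using flat_cl[OF F] x_notin_ground matroid_free_extension delete_free_extension
    by (simp add: principal_extension_def) (simp add: free_extension_def)
qed

end

end

section \<open>Matching matroids\<close>

definition matchable :: "'i set \<Rightarrow> ('i \<Rightarrow> 'a set) \<Rightarrow> 'a set \<Rightarrow> bool" where
  "matchable W A X \<longleftrightarrow> (\<exists>m. inj_on m W \<and> (\<forall>w \<in> W. m w \<in> A w - X))"

lemma matchable_mono:
  assumes "matchable W A X" "W' \<subseteq> W" "\<And>w. w \<in> W' \<Longrightarrow> A w - X \<subseteq> A' w - X'"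
  shows "matchable W' A' X'"
proof -
  obtain m where "inj_on m W" "\<forall>w \<in> W. m w \<in> A w - X" using assms by (auto simp: matchable_def)
  then show ?thesis
    using assms inj_on_subset[of m W W'] unfolding matchable_def by blast
qed

lemma matchable_cong:
  assumes "\<And>w. w \<in> W \<Longrightarrow> A w - X = A' w - X'"
  shows "matchable W A X \<longleftrightarrow> matchable W A' X'"
  using assms by (auto simp: matchable_def)

lemma matchable_empty: "matchable {} A X"
  by (simp add: matchable_def)

text \<open>The representative of the split-off index becomes forbidden for the others. This has the
  same shape as the independence condition for sets containing \<open>x\<close> in a principal
  extension, which is what links the two notions.\<close>

lemma matchable_insert:
  assumes "w \<notin> W"
  shows "matchable (insert w W) A X \<longleftrightarrow> (\<exists>f \<in> A w - X. matchable W A (insert f X))"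
proof
  assume "matchable (insert w W) A X"
  then obtain m where m: "inj_on m (insert w W)" "\<forall>v \<in> insert w W. m v \<in> A v - X"
    by (auto simp: matchable_def)
  then have "matchable W A (insert (m w) X)"
    using assms unfolding matchable_def by (intro exI[of _ m]) (auto simp: inj_on_def)
  then show "\<exists>f \<in> A w - X. matchable W A (insert f X)" using m by auto
next
  assume "\<exists>f \<in> A w - X. matchable W A (insert f X)"
  then obtain f m where f: "f \<in> A w - X" "inj_on m W" "\<forall>v \<in> W. m v \<in> A v - insert f X"
    by (auto simp: matchable_def)
  have "inj_on (m(w := f)) (insert w W)"
    using f assms by (auto simp: inj_on_def)
  then show "matchable (insert w W) A X"
    using f unfolding matchable_def by (intro exI[of _ "m(w := f)"]) auto
qed

text \<open>For finite \<open>V\<close> and \<open>W\<close>, sets inside \<open>V\<close> and a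
  matchable family, this is the dual of the transversal matroid of the family: independent sets
  avoid some full transversal. If the family is not matchable, not even the empty set is
  independent.\<close>

definition matching_matroid :: "'a set \<Rightarrow> 'i set \<Rightarrow> ('i \<Rightarrow> 'a set) \<Rightarrow> 'a pre_matroid" where
  "matching_matroid V W A = \<lparr>ground = V, indep = {X. X \<subseteq> V \<and> matchable W A X}\<rparr>"

lemma ground_matching_matroid [simp]: "ground (matching_matroid V W A) = V"
  by (simp add: matching_matroid_def)

lemma indep_matching_matroid_iff [simp]:
  "X \<in> indep (matching_matroid V W A) \<longleftrightarrow> X \<subseteq> V \<and> matchable W A X"
  by (simp add: matching_matroid_def)

section \<open>Matching matroids are constructed from the empty matroid\<close>

lemma U00_constructed_on_matching_matroid_empty:
  assumes "finite V"
  shows "U00_constructed_on (matching_matroid V {} A)"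
  using assms
proof (induction V rule: finite_induct)
  case empty
  have "matching_matroid {} {} A = empty_matroid"
    by (auto simp: matching_matroid_def empty_matroid_def matchable_empty)
  then show ?case using U00_constructed_on.empty by metis
next
  case (insert x V)
  let ?N = "matching_matroid V {} A"
  have "matroid ?N" using insert.IH by (rule matroid_U00_constructed_on)
  \<comment> \<open>With no sets to match, the matroid is free and each new element is a
    coloop.\<close>
  then have "matching_matroid (insert x V) {} A = add_coloop ?N x"
    using indep_add_coloop_iff[of x ?N] insert.hyps
    by (intro pre_matroid.equality)
      (auto simp: matchable_empty add_coloop_def[THEN arg_cong[of _ _ ground]])
  then show ?case using U00_constructed_on.add_coloop[OF insert.IH, of x] insert.hyps by simp
qed

text \<open>Each set \<open>A w\<close> costs one fresh element \<open>x\<close>, placed freely on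
  \<open>A w\<close> and then contracted. By \<open>matchable_insert\<close>, requiring room for
  \<open>x\<close> is requiring a representative for \<open>A w\<close>. The infinite type
  guarantees that \<open>x\<close> exists.\<close>

lemma U00_constructed_on_matching_matroid:
  fixes V :: "'a set"
  assumes inf: "infinite (UNIV :: 'a set)" and "finite V" "finite W"
    and "\<And>w. w \<in> W \<Longrightarrow> A w \<subseteq> V" and "matchable W A {}"
  shows "U00_constructed_on (matching_matroid V W A)"
  using assms(3-5)
proof (induction W rule: finite_induct)
  case empty
  then show ?case using U00_constructed_on_matching_matroid_empty \<open>finite V\<close> by blast
next
  case (insert w W)
  let ?M = "matching_matroid V W A"
  have "matchable W A {}" using insert.prems(2) by (rule matchable_mono) auto
  then have U: "U00_constructed_on ?M" using insert by blast
  then interpret matroid ?M by (rule matroid_U00_constructed_on)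
  obtain x where x: "x \<notin> V" using ex_new_if_finite[OF inf \<open>finite V\<close>] by blast
  then have x': "x \<notin> ground ?M" by simp
  have Aw: "A w \<subseteq> V" using insert.prems by blast
  let ?N = "free_extension ?M (A w) x"
  have UN: "U00_constructed_on ?N"
    using principal_extension_free_extension[OF x', of "A w"] Aw U
    by (auto intro: U00_constructed_on.principal_extension)
  interpret N: matroid ?N using UN by (rule matroid_U00_constructed_on)
  have ins: "insert x X \<in> indep ?N \<longleftrightarrow> matchable (insert w W) A X" if "X \<subseteq> V" for X
    using that x Aw insert_indep_free_extension_iff[OF x', of X "A w"]
    by (auto simp: matchable_insert[OF insert.hyps(2)])
  have G: "ground ?N = insert x V" by (simp add: free_extension_def)
  \<comment> \<open>Matchability of the enlarged family makes \<open>x\<close> a non-loop, so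
    contracting \<open>x\<close> amounts to adjoining it to the sets tested.\<close>
  have "basis_of ?N {x} {x}" using ins[of "{}"] insert.prems(2) by (simp add: basis_of_def)
  then have "contract ?N {x} = matching_matroid V (insert w W) A"
    using N.indep_contract_iff[of "{x}" "{x}"] ins x N.ground_contract
    by (intro pre_matroid.equality) (auto simp: G)
  then show ?case using U00_constructed_on.contract[OF UN, of "{x}"] G by simp
qed

section \<open>Linkings as matchings\<close>

lemma vwalk_arcs_append: "(u, v) \<in> set (vwalk_arcs (xs @ u # v # ys))"
  by (induction xs) auto

lemma vwalk_arcs_map_upt:
  "vwalk_arcs (map h [0..<Suc n]) = map (\<lambda>i. (h i, h (Suc i))) [0..<n]"
proof -
  \<comment> \<open>The start \<open>k\<close> is generalised because removing the first vertex
    shifts the interval.\<close>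
  have "vwalk_arcs (map h [k..<Suc (k + n)]) = map (\<lambda>i. (h i, h (Suc i))) [k..<k + n]" for k
  proof (induction n arbitrary: k)
    case (Suc n)
    have "vwalk_arcs (map h [k..<Suc (k + Suc n)]) =
        (h k, h (Suc k)) # vwalk_arcs (map h [Suc k..<Suc (Suc k + n)])"
      by (simp add: upt_conv_Cons del: upt_Suc)
    also have "\<dots> = map (\<lambda>i. (h i, h (Suc i))) [k..<k + Suc n]"
      unfolding Suc.IH by (simp add: upt_conv_Cons del: upt_Suc)
    finally show ?case .
  qed simp
  from this[of 0] show ?thesis by simp
qed

text \<open>The vertex belongs to its own star so that vertices used by no path still have a
  representative.\<close>

definition out_star :: "('v, 'e) pre_digraph \<Rightarrow> 'v \<Rightarrow> 'v set" where
  "out_star D v = insert v {u. (v, u) \<in> arcs_ends D}"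

text \<open>In a list without repetitions a vertex determines its position, hence both its successor
  and its predecessor.\<close>

lemma split_at_common_eq:
  assumes "distinct p" "p = xs @ v # u # ys" "p = xs' @ v' # u' # ys'"
  shows "v = v' \<longleftrightarrow> u = u'"
proof -
  let ?i = "length xs" and ?j = "length xs'"
  have "p ! ?i = v" "p ! Suc ?i = u" "Suc ?i < length p"
    by (simp_all add: assms(2) nth_append)
  moreover have "p ! ?j = v'" "p ! Suc ?j = u'" "Suc ?j < length p"
    by (simp_all add: assms(3) nth_append)
  ultimately show ?thesis
    using assms(1) nth_eq_iff_index_eq[of p] by (metis Suc_lessD Suc_inject)
qed

text \<open>Along the paths a vertex is matched to its successor, off the paths to itself.\<close>

lemma matchable_if_linked:
  assumes "linked D X Y" "Y \<subseteq> B"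
  shows "matchable (verts D - B) (out_star D) X"
proof -
  obtain P where P: "\<And>p. p \<in> P \<Longrightarrow> vpath p D"
      and disj: "\<And>p q. p \<in> P \<Longrightarrow> q \<in> P \<Longrightarrow> p \<noteq> q \<Longrightarrow> set p \<inter> set q = {}"
      and hd: "hd ` P = X" and last: "last ` P = Y"
    using assms(1) unfolding linked_def by metis
  \<comment> \<open>The successor relation of the path system; disjointness makes it a partial
    injection.\<close>
  define S where "S v u \<longleftrightarrow> (\<exists>p \<in> P. \<exists>xs ys. p = xs @ v # u # ys)" for v u
  have S_eq: "v = v' \<longleftrightarrow> u = u'" if "S v u" "S v' u'" for v u v' u'
  proof -
    obtain p xs ys where p: "p \<in> P" "p = xs @ v # u # ys" using \<open>S v u\<close> S_def by auto
    obtain q xs' ys' where q: "q \<in> P" "q = xs' @ v' # u' # ys'" using \<open>S v' u'\<close> S_def by auto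
    show ?thesis
    proof (cases "p = q")
      case True
      have "distinct p" using P[OF p(1)] by auto
      then show ?thesis using split_at_common_eq[OF _ p(2), of xs' v' u' ys'] q(2) True by simp
    next
      case False
      then show ?thesis using disj[OF p(1) q(1)] p(2) q(2) by auto
    qed
  qed
  have on_path: "\<exists>u. S v u" if "v \<notin> B" "p \<in> P" "v \<in> set p" for v p
  proof -
    obtain xs zs where p: "p = xs @ v # zs" using \<open>v \<in> set p\<close> by (auto dest: split_list)
    have "last p \<in> B" using \<open>p \<in> P\<close> last assms(2) by auto
    then have "zs \<noteq> []" using p \<open>v \<notin> B\<close> by auto
    then show ?thesis using p \<open>p \<in> P\<close> S_def by (cases zs) auto
  qed
  define m where "m v = (if \<exists>u. S v u then SOME u. S v u else v)" for v
  have m_S: "S v (m v)" if "\<exists>u. S v u" for v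
    using that by (auto simp: m_def intro: someI)
  have S_verts: "u \<in> \<Union> (set ` P)" "v \<in> \<Union> (set ` P)" "u \<notin> X" "(v, u) \<in> arcs_ends D"
    if "S v u" for v u
  proof -
    obtain p xs ys where p: "p \<in> P" "p = xs @ v # u # ys" using \<open>S v u\<close> S_def by auto
    show "u \<in> \<Union> (set ` P)" "v \<in> \<Union> (set ` P)" using p by force+
    have dist: "distinct p" and arcs: "set (vwalk_arcs p) \<subseteq> arcs_ends D"
      using P[OF p(1)] by auto
    show "(v, u) \<in> arcs_ends D" using arcs vwalk_arcs_append p(2) by fastforce
    \<comment> \<open>A vertex of \<open>X\<close> heads its path, which by disjointness must be
      \<open>p\<close>; a head of \<open>p\<close> cannot also be a successor in
      \<open>p\<close>.\<close>
    show "u \<notin> X"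
    proof
      assume "u \<in> X"
      then obtain q where q: "q \<in> P" "u = hd q" using hd by auto
      have "q \<noteq> []" using P[OF q(1)] by auto
      then have "u \<in> set q" using q by simp
      then have "q = p" using disj[OF q(1) p(1)] p(2) by auto
      moreover have "hd p = hd (xs @ [v])" unfolding p(2) by (cases xs) auto
      ultimately have "u = hd (xs @ [v])" using q(2) by simp
      then show False using p(2) dist hd_in_set[of "xs @ [v]"] by auto
    qed
  qed
  have off_path: "v \<notin> \<Union> (set ` P)" "m v = v" if "\<nexists>u. S v u" "v \<notin> B" for v
    using that on_path by (auto simp: m_def)
  have "inj_on m (verts D - B)"
  proof (rule inj_onI)
    fix v v' assume v: "v \<in> verts D - B" "v' \<in> verts D - B" "m v = m v'"
    show "v = v'"
    proof (cases "(\<exists>u. S v u) \<and> (\<exists>u. S v' u)")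
      case True
      then show ?thesis using S_eq m_S v(3) by blast
    next
      \<comment> \<open>A vertex without successor is fixed and lies off the paths, while a vertex
        with successor is sent onto a path, so the mixed case cannot occur.\<close>
      case False
      then show ?thesis using off_path m_S S_verts(1) v by (metis DiffD2)
    qed
  qed
  moreover have "m v \<in> out_star D v - X" if "v \<in> verts D - B" for v
  proof (cases "\<exists>u. S v u")
    case True
    then show ?thesis using m_S[of v] S_verts(3,4)[of v "m v"] by (auto simp: out_star_def)
  next
    case False
    have "x \<in> \<Union> (set ` P)" if "x \<in> X" for x
    proof -
      obtain p where "p \<in> P" "x = hd p" using hd \<open>x \<in> X\<close> by auto
      moreover from this have "p \<noteq> []" using P by auto
      ultimately show ?thesis using hd_in_set by blast
    qed
    then show ?thesis using off_path[OF False] that by (auto simp: out_star_def)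
  qed
  ultimately show ?thesis unfolding matchable_def by blast
qed

text \<open>Conversely, the paths are the orbits of \<open>X\<close> under the matching, up to the first visit
  to \<open>B\<close>. They are disjoint because the matching is injective and misses \<open>X\<close>.\<close>

lemma linked_if_matchable:
  assumes "fin_digraph D" and X: "X \<subseteq> verts D"
    and "matchable (verts D - B) (out_star D) X"
  obtains Y where "Y \<subseteq> B" "linked D X Y"
proof -
  interpret fin_digraph D by fact
  obtain m where inj: "inj_on m (verts D - B)"
      and m: "\<And>v. v \<in> verts D - B \<Longrightarrow> m v \<in> out_star D v - X"
    using assms(3) by (auto simp: matchable_def)
  have m_verts: "m v \<in> verts D" if "v \<in> verts D - B" for v
  proof -
    have "m v = v \<or> (v, m v) \<in> arcs_ends D" using m[OF that] by (auto simp: out_star_def)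
    then show ?thesis using that by (auto simp: arcs_ends_conv)
  qed
  \<comment> \<open>Only iterates strictly before \<open>i\<close> must avoid \<open>B\<close>: then
    \<open>m\<close> has been applied inside its domain, while the \<open>i\<close>-th iterate may
    already lie in \<open>B\<close>.\<close>
  define good where "good x i \<longleftrightarrow> (\<forall>j < i. (m ^^ j) x \<notin> B)" for x i
  have in_verts: "(m ^^ i) x \<in> verts D" if "x \<in> X" "good x i" for x i
    using that
  proof (induction i)
    case (Suc i)
    then have "(m ^^ i) x \<in> verts D - B" by (auto simp: good_def)
    then show ?case using m_verts by simp
  qed (use X in auto)
  \<comment> \<open>Injectivity strips \<open>m\<close> from both sides. If one side runs out first,
    an element of \<open>X\<close> lies in the image of \<open>m\<close>, which misses
    \<open>X\<close>.\<close>
  have eq: "i = j \<and> x = y"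
    if "x \<in> X" "y \<in> X" "good x i" "good y j" "(m ^^ i) x = (m ^^ j) y" for x y i j
    using that(3-5)
  proof (induction i arbitrary: j)
    case 0
    show ?case
    proof (cases j)
      case (Suc k)
      have "(m ^^ k) y \<in> verts D - B"
        using in_verts[of y k] \<open>y \<in> X\<close> 0 Suc by (auto simp: good_def)
      then show ?thesis using m 0 Suc \<open>x \<in> X\<close> by auto
    qed (use 0 in auto)
  next
    case (Suc i)
    have i: "(m ^^ i) x \<in> verts D - B"
      using in_verts[of x i] \<open>x \<in> X\<close> Suc.prems by (auto simp: good_def)
    show ?case
    proof (cases j)
      case 0
      then show ?thesis using m[OF i] Suc.prems \<open>y \<in> X\<close> by auto
    next
      case (Suc k)
      have "(m ^^ k) y \<in> verts D - B"
        using in_verts[of y k] \<open>y \<in> X\<close> Suc.prems Suc by (auto simp: good_def)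
      then have "(m ^^ i) x = (m ^^ k) y"
        using inj_onD[OF inj _ i] Suc.prems(3) Suc by auto
      then show ?thesis using Suc.IH[of k] Suc.prems Suc by (auto simp: good_def)
    qed
  qed
  have reaches: "\<exists>k. (m ^^ k) x \<in> B" if x: "x \<in> X" for x
  proof (rule ccontr)
    \<comment> \<open>An orbit avoiding \<open>B\<close> would never repeat, by \<open>eq\<close>,
      contradicting finiteness of the digraph.\<close>
    assume "\<nexists>k. (m ^^ k) x \<in> B"
    then have good: "good x i" for i by (auto simp: good_def)
    have "inj (\<lambda>i. (m ^^ i) x)"
      using eq[OF x x good good] by (auto intro: injI)
    moreover have "range (\<lambda>i. (m ^^ i) x) \<subseteq> verts D" using in_verts[OF x good] by auto
    ultimately show False
      using finite_verts finite_subset finite_imageD infinite_UNIV_nat by metis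
  qed
  define k where "k x = (LEAST k. (m ^^ k) x \<in> B)" for x
  have k_B: "(m ^^ k x) x \<in> B" if "x \<in> X" for x
    using LeastI_ex[OF reaches[OF that]] by (simp add: k_def)
  have good_k: "good x i" if "i \<le> k x" for x i
    unfolding good_def
  proof (intro allI impI)
    fix j assume "j < i"
    then have "j < (LEAST k. (m ^^ k) x \<in> B)" using that by (simp add: k_def)
    then show "(m ^^ j) x \<notin> B" by (rule not_less_Least)
  qed
  define p where "p x = map (\<lambda>i. (m ^^ i) x) [0..<Suc (k x)]" for x
  have set_p: "set (p x) = (\<lambda>i. (m ^^ i) x) ` {..k x}" for x
    unfolding p_def set_map set_upt atLeast0LessThan lessThan_Suc_atMost ..
  have hd_p: "hd (p x) = x" for x by (simp add: p_def hd_map del: upt_Suc)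
  have last_p: "last (p x) = (m ^^ k x) x" for x by (simp add: p_def)
  have "vpath (p x) D" if x: "x \<in> X" for x
  proof (intro vpathI vwalkI)
    show "distinct (p x)"
      using eq[OF x x good_k good_k]
      by (auto simp: p_def distinct_map inj_on_def simp del: upt_Suc)
    show "set (p x) \<subseteq> verts D" using in_verts[OF x good_k] by (auto simp: set_p)
    show "p x \<noteq> []" by (simp add: p_def)
    have "((m ^^ i) x, (m ^^ Suc i) x) \<in> arcs_ends D" if i: "i < k x" for i
    proof -
      have "(m ^^ i) x \<in> verts D - B"
        using in_verts[OF x good_k, of i] i good_k[of "Suc i" x] by (auto simp: good_def)
      \<comment> \<open>The iterates differ, so \<open>m\<close> follows an arc here and does not
        use the vertex itself from its star.\<close>
      moreover have "(m ^^ Suc i) x \<noteq> (m ^^ i) x"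
        using eq[OF x x good_k good_k, of "Suc i" i] i by auto
      ultimately show ?thesis using m[of "(m ^^ i) x"] by (auto simp: out_star_def)
    qed
    then show "set (vwalk_arcs (p x)) \<subseteq> arcs_ends D"
      unfolding p_def vwalk_arcs_map_upt by auto
  qed
  moreover have "set (p x) \<inter> set (p y) = {}" if "x \<in> X" "y \<in> X" "p x \<noteq> p y" for x y
    using eq[OF that(1,2) good_k good_k] that(3) by (auto simp: set_p)
  ultimately have "linked D X (last ` p ` X)"
    unfolding linked_def by (intro exI[of _ "p ` X"]) (auto simp: hd_p image_image)
  moreover have "last ` p ` X \<subseteq> B" using k_B by (auto simp: last_p)
  ultimately show ?thesis using that by blast
qed

text \<open>Joins the two translations above. That \<open>X\<close> consists of vertices has to be
  read off the linking paths, as \<open>strict_gammoid\<close> does not demand it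
  separately.\<close>

lemma strict_gammoid_eq_matching_matroid:
  assumes "fin_digraph D"
  shows "strict_gammoid D B = matching_matroid (verts D) (verts D - B) (out_star D)"
proof -
  have "X \<subseteq> verts D" if L: "linked D X Y" for X Y
  proof -
    obtain P where P: "\<forall>p \<in> P. vpath p D" "hd ` P = X"
      using L unfolding linked_def by blast
    have "hd p \<in> verts D" if "p \<in> P" for p
      using P(1) that hd_in_set[of p] unfolding vpath_def vwalk_def by blast
    then show ?thesis using P(2) by auto
  qed
  then have "(\<exists>Y \<subseteq> B. linked D X Y) \<longleftrightarrow>
      X \<subseteq> verts D \<and> matchable (verts D - B) (out_star D) X" for X
    using matchable_if_linked linked_if_matchable[OF assms] by metis
  then show ?thesis by (simp add: strict_gammoid_def matching_matroid_def)
qed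

section \<open>Gammoids are constructed from the empty matroid\<close>

lemma U00_constructed_on_strict_gammoid:
  fixes D :: "('v, 'e) pre_digraph"
  assumes "infinite (UNIV :: 'v set)" "fin_digraph D"
  shows "U00_constructed_on (strict_gammoid D B)"
proof -
  interpret fin_digraph D by fact
  have "out_star D v \<subseteq> verts D" if "v \<in> verts D" for v
    using that by (auto simp: out_star_def arcs_ends_conv)
  \<comment> \<open>Every vertex represents its own star.\<close>
  moreover have "matchable (verts D - B) (out_star D) {}"
    unfolding matchable_def by (intro exI[of _ id]) (auto simp: out_star_def)
  ultimately show ?thesis
    unfolding strict_gammoid_eq_matching_matroid[OF assms(2)]
    by (intro U00_constructed_on_matching_matroid assms) auto
qed

lemma gammoid_imp_U00_constructed:
  assumes "gammoid M"
  shows "U00_constructed M"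
proof -
  obtain D :: "(nat, nat \<times> nat) pre_digraph" and B X f where
    D: "fin_digraph D" "X \<subseteq> verts D" "inj_on f X" "M = relabel f (restrict (strict_gammoid D B) X)"
    using assms by (auto simp: gammoid_def)
  have "ground (strict_gammoid D B) = verts D" by (simp add: strict_gammoid_def)
  then have "U00_constructed_on (restrict (strict_gammoid D B) X)"
    using U00_constructed_on_strict_gammoid[OF infinite_UNIV_nat D(1), of B]
    by (auto simp: restrict_def intro: U00_constructed_on.delete)
  moreover have "ground (restrict (strict_gammoid D B) X) = X"
    using D(2) by (auto simp: restrict_def delete_def strict_gammoid_def)
  ultimately show ?thesis
    unfolding U00_constructed_def using D(3,4) by (intro exI conjI) simp_all
qed

section \<open>Matching presentations\<close>

text \<open>Numbers outside the image of \<open>g\<close> play the part of deleted elements. The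
  embedding into \<open>nat\<close> leaves room for them, and for fresh elements, even when the type
  \<open>'a\<close> is finite.\<close>

definition matching_presented :: "'a pre_matroid \<Rightarrow> bool" where
  "matching_presented M \<longleftrightarrow>
    (\<exists>(W :: nat set) (A :: nat \<Rightarrow> nat set) (g :: 'a \<Rightarrow> nat).
      finite W \<and> (\<forall>w \<in> W. finite (A w)) \<and> inj_on g (ground M) \<and>
      (\<forall>X. X \<in> indep M \<longleftrightarrow> X \<subseteq> ground M \<and> matchable W A (g ` X)))"

lemma matching_presentedI:
  fixes W :: "nat set" and A :: "nat \<Rightarrow> nat set"
  assumes "finite W" "\<And>w. w \<in> W \<Longrightarrow> finite (A w)" "inj_on g (ground M)"
    and "\<And>X. X \<in> indep M \<Longrightarrow> X \<subseteq> ground M"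
    and "\<And>X. X \<subseteq> ground M \<Longrightarrow> X \<in> indep M \<longleftrightarrow> matchable W A (g ` X)"
  shows "matching_presented M"
  unfolding matching_presented_def
  using assms by (intro exI[of _ W] exI[of _ A] exI[of _ g]) metis

lemma matching_presentedE:
  assumes "matching_presented M"
  obtains W :: "nat set" and A :: "nat \<Rightarrow> nat set" and g where
    "finite W" "\<And>w. w \<in> W \<Longrightarrow> finite (A w)" "inj_on g (ground M)"
    "\<And>X. X \<in> indep M \<longleftrightarrow> X \<subseteq> ground M \<and> matchable W A (g ` X)"
proof -
  obtain W :: "nat set" and A :: "nat \<Rightarrow> nat set" and g where
    "finite W" "\<forall>w \<in> W. finite (A w)" "inj_on g (ground M)"
    "\<forall>X. X \<in> indep M \<longleftrightarrow> X \<subseteq> ground M \<and> matchable W A (g ` X)"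
    using assms unfolding matching_presented_def by (elim exE conjE)
  then show ?thesis by (intro that[of W A g]) auto
qed

section \<open>Matching presentations survive every operation\<close>

lemma matching_presented_empty: "matching_presented empty_matroid"
  by (rule matching_presentedI[of "{}"]) (auto simp: empty_matroid_def matchable_empty)

lemma matching_presented_relabel:
  assumes "matching_presented M" and f: "inj_on f (ground M)"
  shows "matching_presented (relabel f M)"
proof -
  obtain W :: "nat set" and A :: "nat \<Rightarrow> nat set" and g
    where W: "finite W" "\<And>w. w \<in> W \<Longrightarrow> finite (A w)"
    and g: "inj_on g (ground M)"
    and ind: "\<And>X. X \<in> indep M \<longleftrightarrow> X \<subseteq> ground M \<and> matchable W A (g ` X)"
    using assms(1) by (rule matching_presentedE) blast
  let ?h = "inv_into (ground M) f"
  show ?thesis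
  proof (rule matching_presentedI[of W A "g \<circ> ?h"])
    have "?h ` f ` ground M = ground M" using f by simp
    moreover have "inj_on ?h (f ` ground M)" by (simp add: inj_on_inv_into)
    ultimately show "inj_on (g \<circ> ?h) (ground (relabel f M))"
      using g by (auto simp: relabel_def intro: comp_inj_on)
  next
    fix X assume "X \<subseteq> ground (relabel f M)"
    then obtain I where I: "I \<subseteq> ground M" "X = f ` I"
      by (auto simp: relabel_def subset_image_iff)
    then have hX: "?h ` X = I" using f by simp
    have "X \<in> indep (relabel f M) \<longleftrightarrow> I \<in> indep M"
      using I f ind by (auto simp: relabel_def inj_on_image_eq_iff)
    then show "X \<in> indep (relabel f M) \<longleftrightarrow> matchable W A ((g \<circ> ?h) ` X)"
      using I(1) ind by (simp only: image_comp[symmetric] hX) simp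
  next
    fix X assume "X \<in> indep (relabel f M)"
    then show "X \<subseteq> ground (relabel f M)" using ind by (auto simp: relabel_def)
  qed (use W in auto)
qed

text \<open>The same family works: deleted elements remain available as representatives but are
  never forbidden.\<close>

lemma matching_presented_delete:
  assumes "matching_presented M"
  shows "matching_presented (delete M X)"
proof -
  obtain W :: "nat set" and A :: "nat \<Rightarrow> nat set" and g
    where W: "finite W" "\<And>w. w \<in> W \<Longrightarrow> finite (A w)"
    and g: "inj_on g (ground M)"
    and ind: "\<And>X. X \<in> indep M \<longleftrightarrow> X \<subseteq> ground M \<and> matchable W A (g ` X)"
    using assms(1) by (rule matching_presentedE) blast
  then show ?thesis
    by (intro matching_presentedI[of W A g]) (auto simp: delete_def intro: inj_on_subset)
qed

text \<open>Testing \<open>X\<close> in the contraction means forbidding \<open>X \<union> Y\<close>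
  in \<open>M\<close>, and \<open>Y\<close> can be removed from the sets once and for all. The rest
  of \<open>C\<close> stays available, as if deleted.\<close>

lemma matching_presented_contract:
  assumes "matching_presented M" "matroid M" "C \<subseteq> ground M"
  shows "matching_presented (contract M C)"
proof -
  interpret matroid M by fact
  obtain W :: "nat set" and A :: "nat \<Rightarrow> nat set" and g
    where W: "finite W" "\<And>w. w \<in> W \<Longrightarrow> finite (A w)"
    and g: "inj_on g (ground M)"
    and ind: "\<And>X. X \<in> indep M \<longleftrightarrow> X \<subseteq> ground M \<and> matchable W A (g ` X)"
    using assms(1) by (rule matching_presentedE) blast
  obtain Y where Y: "basis_of M Y C" by (rule basis_of_exists)
  then have YE: "Y \<subseteq> ground M" using assms(3) by (auto simp: basis_of_def)
  have "matchable W (\<lambda>w. A w - g ` Y) (g ` X) \<longleftrightarrow> matchable W A (g ` (X \<union> Y))" for X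
    by (rule matchable_cong) auto
  then show ?thesis
    using W g ind YE indep_contract_iff[OF assms(3) Y] ground_contract[of C]
    by (intro matching_presentedI[of W "\<lambda>w. A w - g ` Y" g]) (auto intro: inj_on_subset)
qed

text \<open>A coloop is represented by a number in none of the sets, so forbidding it changes
  nothing.\<close>

lemma matching_presented_add_coloop:
  assumes "matching_presented M" "matroid M" "x \<notin> ground M"
  shows "matching_presented (add_coloop M x)"
proof -
  interpret matroid M by fact
  obtain W :: "nat set" and A :: "nat \<Rightarrow> nat set" and g
    where W: "finite W" "\<And>w. w \<in> W \<Longrightarrow> finite (A w)"
    and g: "inj_on g (ground M)"
    and ind: "\<And>X. X \<in> indep M \<longleftrightarrow> X \<subseteq> ground M \<and> matchable W A (g ` X)"
    using assms(1) by (rule matching_presentedE) blast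
  have "finite (\<Union> (A ` W) \<union> g ` ground M)" using W finite_ground by auto
  then obtain n where n: "n \<notin> \<Union> (A ` W) \<union> g ` ground M"
    using ex_new_if_finite[OF infinite_UNIV_nat] by blast
  let ?g = "g(x := n)"
  have G: "ground (add_coloop M x) = insert x (ground M)" by (simp add: add_coloop_def)
  have "matchable W A (?g ` X) \<longleftrightarrow> matchable W A (g ` (X - {x}))" for X
    using n by (intro matchable_cong) auto
  then show ?thesis
    using W g n ind indep_add_coloop_iff[OF assms(3,2)] assms(3)
    by (intro matching_presentedI[of W A ?g]) (auto simp: G inj_on_def)
qed

text \<open>If \<open>x\<close> is not forbidden, it represents the new set and the old condition
  remains. If it is forbidden, the new set must use some \<open>f\<close> of \<open>F\<close>
  outside \<open>X\<close>, which then is forbidden for the old sets; this is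
  \<open>principal_extension_indep_iff\<close>.\<close>

lemma matching_presented_principal_extension:
  assumes "matching_presented M" "matroid M" "principal_extension M F x M'"
  shows "matching_presented M'"
proof -
  interpret matroid M by fact
  have x: "x \<notin> ground M" and G: "ground M' = insert x (ground M)" and FE: "F \<subseteq> ground M"
    and "matroid M'"
    using assms(3) by (auto simp: principal_extension_def flat_def)
  interpret M': matroid M' by fact
  obtain W :: "nat set" and A :: "nat \<Rightarrow> nat set" and g
    where W: "finite W" "\<And>w. w \<in> W \<Longrightarrow> finite (A w)"
    and g: "inj_on g (ground M)"
    and ind: "\<And>X. X \<in> indep M \<longleftrightarrow> X \<subseteq> ground M \<and> matchable W A (g ` X)"
    using assms(1) by (rule matching_presentedE) blast
  \<comment> \<open>One number \<open>n\<close> serves both as the index of the new set and as the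
    image of \<open>x\<close>, so it must avoid the indices, the sets and the image of
    \<open>g\<close>.\<close>
  have "finite (W \<union> \<Union> (A ` W) \<union> g ` ground M)" using W finite_ground by auto
  from ex_new_if_finite[OF infinite_UNIV_nat this] obtain n
    where n: "n \<notin> W" "n \<notin> \<Union> (A ` W)" "n \<notin> g ` ground M" by auto
  let ?g = "g(x := n)" and ?A = "A(n := insert n (g ` F))"
  have drop_n: "matchable W ?A (insert n Z) \<longleftrightarrow> matchable W A Z" for Z
  proof (rule matchable_cong)
    fix w assume w: "w \<in> W"
    then have "w \<noteq> n" "n \<notin> A w" using n by auto
    then show "?A w - insert n Z = A w - Z" by auto
  qed
  have mat: "matchable (insert n W) ?A Z \<longleftrightarrow>
      (\<exists>f \<in> insert n (g ` F) - Z. matchable W ?A (insert f Z))" for Z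
    using matchable_insert[OF n(1), of ?A Z] by simp
  show ?thesis
  proof (rule matching_presentedI[of "insert n W" ?A ?g])
    show "inj_on ?g (ground M')" using g n x by (auto simp: G inj_on_def)
  next
    fix X assume X: "X \<subseteq> ground M'"
    show "X \<in> indep M' \<longleftrightarrow> matchable (insert n W) ?A (?g ` X)"
    proof (cases "x \<in> X")
      case False
      then have X': "X \<subseteq> ground M" "?g ` X = g ` X" "n \<notin> g ` X" using X G n by auto
      have "matchable W A (g ` X)" if "matchable W ?A (insert f (g ` X))" for f
        using that by (rule matchable_mono) (use n(1) in \<open>auto split: if_splits\<close>)
      \<comment> \<open>Any representative of the new set leaves a matching of the old sets;
        conversely \<open>n\<close> is a representative that no old set can use.\<close>
      then have "matchable (insert n W) ?A (g ` X) \<longleftrightarrow> matchable W A (g ` X)"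
        unfolding mat using X'(3) drop_n by blast
      then show ?thesis
        using False X' ind principal_extension_indep_iff[OF assms(2,3), of X] by simp
    next
      case True
      define I where "I = X - {x}"
      have I: "X = insert x I" "x \<notin> I" "I \<subseteq> ground M" using True X G by (auto simp: I_def)
      have gX: "?g ` X = insert n (g ` I)" using I by auto
      have "n \<notin> g ` F" using n(3) FE by auto
      then have "insert n (g ` F) - insert n (g ` I) = g ` (F - I)"
        using inj_on_image_set_diff[OF g, of F I] FE I(3) by auto
      then have "matchable (insert n W) ?A (?g ` X) \<longleftrightarrow>
          (\<exists>f \<in> F - I. matchable W ?A (insert (g f) (insert n (g ` I))))"
        unfolding mat gX by simp
      also have "\<dots> \<longleftrightarrow> (\<exists>f \<in> F - I. insert f I \<in> indep M)"
        using drop_n ind I(3) FE by (subst insert_commute) auto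
      also have "\<dots> \<longleftrightarrow> I \<in> indep M \<and> (\<exists>f \<in> F - I. insert f I \<in> indep M)"
        using indep_subset by blast
      also have "F - I = F - X" using I(1) FE x by auto
      finally show ?thesis
        unfolding I_def using True principal_extension_indep_iff[OF assms(2,3), of X] by metis
    qed
  next
    fix w assume "w \<in> insert n W"
    then show "finite (?A w)" using W(2) finite_subset[OF FE finite_ground] by auto
  next
    show "finite (insert n W)" using W(1) by simp
  next
    fix X assume "X \<in> indep M'"
    then show "X \<subseteq> ground M'" by (rule M'.indep_subset_ground)
  qed
qed

lemma matching_presented_U00_constructed_on:
  "U00_constructed_on M \<Longrightarrow> matching_presented M"
proof (induction rule: U00_constructed_on.induct)
  case empty
  show ?case by (rule matching_presented_empty)
next
  case relabel
  then show ?case by (intro matching_presented_relabel)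
next
  case delete
  then show ?case by (intro matching_presented_delete)
next
  case contract
  then show ?case by (intro matching_presented_contract matroid_U00_constructed_on)
next
  case add_coloop
  then show ?case by (intro matching_presented_add_coloop matroid_U00_constructed_on)
next
  case (principal_extension M F x M')
  then show ?case
    by (intro matching_presented_principal_extension[of M F x M'] matroid_U00_constructed_on)
qed

section \<open>From matching presentations back to gammoids\<close>

lemma matchable_reindex:
  assumes "inj_on h W"
  shows "matchable (h ` W) A X \<longleftrightarrow> matchable W (A \<circ> h) X"
proof
  assume "matchable (h ` W) A X"
  then obtain m where "inj_on m (h ` W)" "\<forall>v \<in> h ` W. m v \<in> A v - X"
    by (auto simp: matchable_def)
  then show "matchable W (A \<circ> h) X"
    using assms unfolding matchable_def by (intro exI[of _ "m \<circ> h"]) (auto intro: comp_inj_on)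
next
  assume "matchable W (A \<circ> h) X"
  then obtain m where "inj_on m W" "\<forall>w \<in> W. m w \<in> A (h w) - X"
    by (auto simp: matchable_def)
  then show "matchable (h ` W) A X"
    using assms unfolding matchable_def
    by (intro exI[of _ "m \<circ> inv_into W h"]) (auto simp: inj_on_def)
qed

text \<open>A matching of the indices turns them into vertices \<open>v\<close> with \<open>v \<in> A v\<close>, so that \<open>A v\<close> is
  the out-star of \<open>v\<close> in a digraph.\<close>

lemma gammoid_if_matching_presented:
  assumes "matching_presented M" "matroid M"
  shows "gammoid M"
proof -
  interpret matroid M by fact
  obtain W :: "nat set" and A :: "nat \<Rightarrow> nat set" and g
    where W: "finite W" "\<And>w. w \<in> W \<Longrightarrow> finite (A w)"
    and g: "inj_on g (ground M)"
    and ind: "\<And>X. X \<in> indep M \<longleftrightarrow> X \<subseteq> ground M \<and> matchable W A (g ` X)"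
    using assms(1) by (rule matching_presentedE) blast
  have "matchable W A {}" using ind indep_empty by auto
  then obtain h where h: "inj_on h W" "\<And>w. w \<in> W \<Longrightarrow> h w \<in> A w"
    by (auto simp: matchable_def)
  define V where "V = \<Union> (A ` W) \<union> g ` ground M"
  \<comment> \<open>Each \<open>h w\<close> gets arcs to all of \<open>A w\<close>, including a loop
    at itself; injectivity of \<open>h\<close> keeps the stars of different indices apart.\<close>
  define D :: "(nat, nat \<times> nat) pre_digraph"
    where "D = \<lparr>verts = V, arcs = (\<Union>w \<in> W. {h w} \<times> A w), tail = fst, head = snd\<rparr>"
  \<comment> \<open>With this choice the vertices outside \<open>B\<close> are exactly the values of
    \<open>h\<close> on \<open>W\<close>, so their stars are exactly the sets
    \<open>A w\<close>.\<close>
  define B where "B = V - h ` W"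
  have finV: "finite V" using W finite_ground by (auto simp: V_def)
  have hV: "h ` W \<subseteq> V" using h(2) by (auto simp: V_def)
  have fin: "fin_digraph D"
  proof
    show "finite (verts D)" using finV by (simp add: D_def)
    show "finite (arcs D)" using W by (simp add: D_def)
    show "tail D e \<in> verts D" "head D e \<in> verts D" if "e \<in> arcs D" for e
      using that hV by (fastforce simp: D_def V_def)+
  qed
  have ends: "(v, u) \<in> arcs_ends D \<longleftrightarrow> (\<exists>w \<in> W. v = h w \<and> u \<in> A w)" for u v
    by (auto simp: arcs_ends_conv D_def image_iff)
  have "{u. (h w, u) \<in> arcs_ends D} = A w" if "w \<in> W" for w
    unfolding ends using that inj_onD[OF h(1)] by blast
  then have "out_star D (h w) = A w" if "w \<in> W" for w
    using that h(2) by (simp add: out_star_def insert_absorb)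
  then have star: "matchable (h ` W) (out_star D) Z \<longleftrightarrow> matchable W A Z" for Z
    unfolding matchable_reindex[OF h(1)] by (intro matchable_cong) auto
  have VB: "V - B = h ` W" using hV by (auto simp: B_def)
  define N where "N = restrict (strict_gammoid D B) (g ` ground M)"
  have "verts D = V" by (simp add: D_def)
  then have SG: "strict_gammoid D B = matching_matroid V (h ` W) (out_star D)"
    using strict_gammoid_eq_matching_matroid[OF fin, of B] VB by simp
  have gV: "g ` ground M \<subseteq> V" by (auto simp: V_def)
  have gN: "ground N = g ` ground M"
    using gV by (auto simp: N_def restrict_def SG delete_def)
  have iN: "Z \<in> indep N \<longleftrightarrow> Z \<subseteq> g ` ground M \<and> matchable W A Z" for Z
    using gV by (auto simp: N_def restrict_def SG delete_def star)
  \<comment> \<open>The presentation embeds \<open>M\<close> into \<open>nat\<close>, whereas a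
    gammoid is relabelled out of \<open>nat\<close>; the inverse of \<open>g\<close> reverses the
    direction.\<close>
  let ?f = "inv_into (ground M) g"
  have "indep M = (`) ?f ` indep N"
  proof (intro equalityI subsetI)
    fix X assume X: "X \<in> indep M"
    then have "g ` X \<in> indep N" using ind iN by auto
    moreover have "X = ?f ` g ` X" using g X ind by simp
    ultimately show "X \<in> (`) ?f ` indep N" by blast
  next
    fix X assume "X \<in> (`) ?f ` indep N"
    then obtain Z where Z: "X = ?f ` Z" "Z \<in> indep N" by auto
    then obtain Y where Y: "Y \<subseteq> ground M" "Z = g ` Y" using iN by (auto simp: subset_image_iff)
    then have "X = Y" using Z g by simp
    then show "X \<in> indep M" using Y Z ind iN by auto
  qed
  then have "M = relabel ?f N" using g gN by (auto simp: relabel_def intro!: pre_matroid.equality)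
  moreover have "inj_on ?f (g ` ground M)" by (simp add: inj_on_inv_into)
  moreover have "B \<subseteq> verts D" "g ` ground M \<subseteq> verts D"
    using gV \<open>verts D = V\<close> by (auto simp: B_def)
  ultimately show ?thesis unfolding gammoid_def N_def using fin by blast
qed

lemma U00_constructed_imp_gammoid:
  assumes "U00_constructed M"
  shows "gammoid M"
proof -
  obtain N :: "nat pre_matroid" and f where
    N: "U00_constructed_on N" "inj_on f (ground N)" "M = relabel f N"
    using assms by (auto simp: U00_constructed_def)
  have "matching_presented M"
    unfolding N(3) using N(1,2)
    by (intro matching_presented_relabel matching_presented_U00_constructed_on)
  moreover have "matroid M"
    unfolding N(3) using N(1,2) by (intro matroid_relabel matroid_U00_constructed_on)
  ultimately show ?thesis by (rule gammoid_if_matching_presented)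
qed

theorem theorem3p3:
  fixes M :: "'a pre_matroid"
  assumes "matroid M"
  shows "gammoid M \<longleftrightarrow> U00_constructed M"
  using gammoid_imp_U00_constructed U00_constructed_imp_gammoid by blast

end
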